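(* In the plane let $J=\{(0,y):-1\le y\le1\}$, $I=\{(x,0):0\le x\le1\}$, and $I_n=\{(x,0):\frac1n\le x\le1\}$ for $n\in\mathbb N$, $n\ge1$. Endow the triode $X=J\cup I$ with its intrinsic metric (the length of the shortest path inside $X$ between two points), and its subsets $X_n=J\cup I_n$ with the metric induced by this intrinsic metric of $X$. Then the sequence of metric spaces $X_n$, $n\in\mathbb N$, is fundamental (Cauchy) with respect to $d^c_{GH}$, but no metric space is its limit with respect to $d^c_{GH}$: there is no metric space $X_\infty$ with $d^c_{GH}(X_n,X_\infty)\to0$.
   Context: All metric spaces are non-empty; $|xx'|$ denotes the distance between points $x,x'$ of a metric space. For maps $f\colon X\to Y$ and $g\colon Y\to X$ between metric spaces put $$\operatorname{dis} f=\sup_{x,x'\in X}\bigl||xx'|-|f(x)f(x')|\bigr|,\qquad \operatorname{codis}(f,g)=\sup_{x\in X,\,y\in Y}\bigl||x\,g(y)|-|f(x)\,y|\bigr|$$ ($\operatorname{dis} g$ is defined analogously). The continuous Gromov--Hausdorff distance is $d^c_{GH}(X,Y)=\frac12\inf\max\{\operatorname{dis} f,\operatorname{dis} g,\operatorname{codis}(f,g)\}\in[0,\infty]$, the infimum being over all continuous maps $f\colon X\to Y$ and $g\colon Y\to X$. *)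

theory Defs
  imports "HOL-Analysis.Analysis"
begin

definition distortion :: "'a metric \<Rightarrow> 'b metric \<Rightarrow> ('a \<Rightarrow> 'b) \<Rightarrow> ennreal" where
  "distortion X Y f =
     (SUP x\<in>mspace X. SUP x'\<in>mspace X. ennreal \<bar>mdist X x x' - mdist Y (f x) (f x')\<bar>)"

definition codistortion :: "'a metric \<Rightarrow> 'b metric \<Rightarrow> ('a \<Rightarrow> 'b) \<Rightarrow> ('b \<Rightarrow> 'a) \<Rightarrow> ennreal" where
  "codistortion X Y f g =
     (SUP x\<in>mspace X. SUP y\<in>mspace Y. ennreal \<bar>mdist X x (g y) - mdist Y (f x) y\<bar>)"

text \<open>The type \<open>'a metric\<close> also contains the empty space; non-emptiness has to be required separately where this definition is used.\<close>

definition dcGH :: "'a metric \<Rightarrow> 'b metric \<Rightarrow> ennreal" where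
  "dcGH X Y =
     (INF (f, g) \<in> {(f, g). continuous_map (mtopology_of X) (mtopology_of Y) f
                          \<and> continuous_map (mtopology_of Y) (mtopology_of X) g}.
        max (distortion X Y f) (max (distortion Y X g) (codistortion X Y f g))) / 2"

text \<open>The length of a path (parametrized by \<open>{0..1}\<close>) is the supremum of the lengths of its
  inscribed polygons with vertices at parameters \<open>t 0 \<le> \<dots> \<le> t n\<close>.\<close>

definition curve_length :: "(real \<Rightarrow> 'a::metric_space) \<Rightarrow> ennreal" where
  "curve_length p =
     (SUP (n, t) \<in> {(n::nat, t::nat \<Rightarrow> real). mono_on {..n} t \<and> t ` {..n} \<subseteq> {0..1}}.
        \<Sum>i<n. ennreal (dist (p (t i)) (p (t (Suc i)))))"

definition intrinsic_edist :: "'a::metric_space set \<Rightarrow> 'a \<Rightarrow> 'a \<Rightarrow> ennreal" where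
  "intrinsic_edist S x y =
     (INF p \<in> {p. path p \<and> path_image p \<subseteq> S \<and> pathstart p = x \<and> pathfinish p = y}. curve_length p)"

text \<open>The type \<open>'a metric\<close> is an abstract type, so \<open>metric (S, _)\<close> is meaningful only when its
  argument is a metric space. This is the case when all points of \<open>S\<close> are at finite intrinsic
  distance, see \<open>Metric_space_intrinsic\<close> below.\<close>

definition intrinsic_metric :: "'a::metric_space set \<Rightarrow> 'a metric" where
  "intrinsic_metric S = metric (S, \<lambda>x y. enn2real (intrinsic_edist S x y))"

lemma curve_length_upper:
  assumes "mono_on {..n} t" "t ` {..n} \<subseteq> {0..1}"
  shows "(\<Sum>i<n. ennreal (dist (p (t i)) (p (t (Suc i))))) \<le> curve_length p"
  unfolding curve_length_def by (rule SUP_upper2[of "(n, t)"]) (use assms in auto)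

lemma curve_length_least:
  assumes "\<And>n t. mono_on {..n} t \<Longrightarrow> t ` {..n} \<subseteq> {0..1} \<Longrightarrow>
             (\<Sum>i<n. ennreal (dist (p (t i)) (p (t (Suc i))))) \<le> L"
  shows "curve_length p \<le> L"
  unfolding curve_length_def by (rule SUP_least) (use assms in auto)

lemma dist_le_curve_length: "ennreal (dist (pathstart p) (pathfinish p)) \<le> curve_length p"
  using curve_length_upper[of 1 real p]
  by (force simp: pathstart_def pathfinish_def mono_on_def image_subset_iff)

lemma curve_length_linepath: "curve_length (linepath a b) \<le> ennreal (dist a b)"
proof (rule curve_length_least)
  fix n and t :: "nat \<Rightarrow> real"
  assume t: "mono_on {..n} t" "t ` {..n} \<subseteq> {0..1}"
  have eq: "dist (linepath a b (t i)) (linepath a b (t (Suc i))) = (t (Suc i) - t i) * dist a b"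
    if "i < n" for i
  proof -
    have "linepath a b (t (Suc i)) - linepath a b (t i) = (t (Suc i) - t i) *\<^sub>R (b - a)"
      by (simp add: linepath_def algebra_simps)
    moreover have "t i \<le> t (Suc i)" using t(1) that by (auto simp: mono_on_def)
    ultimately show ?thesis
      by (metis abs_of_nonneg diff_ge_0_iff_ge dist_commute dist_norm norm_scaleR)
  qed
  have "(\<Sum>i<n. dist (linepath a b (t i)) (linepath a b (t (Suc i))))
      = (\<Sum>i<n. t (Suc i) - t i) * dist a b"
    unfolding sum_distrib_right by (intro sum.cong) (auto simp: eq)
  also have "\<dots> = (t n - t 0) * dist a b"
    by (simp add: sum_lessThan_telescope)
  also have "\<dots> \<le> 1 * dist a b"
  proof (rule mult_right_mono)
    have "t n \<le> 1" "0 \<le> t 0" using t(2) by (auto simp: image_subset_iff)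
    then show "t n - t 0 \<le> 1" by simp
  qed simp
  finally show "(\<Sum>i<n. ennreal (dist (linepath a b (t i)) (linepath a b (t (Suc i)))))
      \<le> ennreal (dist a b)"
    by (simp add: sum_ennreal ennreal_leI)
qed

lemma curve_length_reversepath_le: "curve_length (reversepath p) \<le> curve_length p"
proof (rule curve_length_least)
  fix n and t :: "nat \<Rightarrow> real"
  assume t: "mono_on {..n} t" "t ` {..n} \<subseteq> {0..1}"
  define s where "s = (\<lambda>i. 1 - t (n - i))"
  have "(\<Sum>i<n. ennreal (dist (reversepath p (t i)) (reversepath p (t (Suc i)))))
      = (\<Sum>i<n. ennreal (dist (p (s i)) (p (s (Suc i)))))"
    by (subst sum.nat_diff_reindex[symmetric])
       (intro sum.cong, auto simp: s_def reversepath_def dist_commute Suc_diff_Suc)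
  also have "\<dots> \<le> curve_length p"
  proof (rule curve_length_upper)
    show "mono_on {..n} s" using t(1) by (auto simp: mono_on_def s_def)
    show "s ` {..n} \<subseteq> {0..1}" using t(2) by (auto simp: s_def image_subset_iff)
  qed
  finally show "(\<Sum>i<n. ennreal (dist (reversepath p (t i)) (reversepath p (t (Suc i)))))
      \<le> curve_length p" .
qed

lemma curve_length_joinpaths_le:
  assumes "pathfinish p = pathstart q"
  shows "curve_length (p +++ q) \<le> curve_length p + curve_length q"
proof (rule curve_length_least)
  fix n and t :: "nat \<Rightarrow> real"
  assume t: "mono_on {..n} t" "t ` {..n} \<subseteq> {0..1}"
  define a where "a = (\<lambda>i. min 1 (2 * t i))"
  define b where "b = (\<lambda>i. max 0 (2 * t i - 1))"
  have pq: "p 1 = q 0" using assms by (simp add: pathfinish_def pathstart_def)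
  have le: "dist ((p +++ q) (t i)) ((p +++ q) (t (Suc i)))
      \<le> dist (p (a i)) (p (a (Suc i))) + dist (q (b i)) (q (b (Suc i)))" if "i < n" for i
  proof -
    have m: "t i \<le> t (Suc i)" using t(1) that by (auto simp: mono_on_def)
    consider "t (Suc i) \<le> 1/2" | "t i > 1/2" | "t i \<le> 1/2" "t (Suc i) > 1/2" by linarith
    then show ?thesis
    proof cases
      case 1
      with m have "a i = 2 * t i" "a (Suc i) = 2 * t (Suc i)" by (auto simp: a_def)
      with 1 m show ?thesis by (simp add: joinpaths_def)
    next
      case 2
      with m have "b i = 2 * t i - 1" "b (Suc i) = 2 * t (Suc i) - 1" by (auto simp: b_def)
      with 2 m show ?thesis by (simp add: joinpaths_def)
    next
      case 3
      then have "a i = 2 * t i" "a (Suc i) = 1" "b i = 0" "b (Suc i) = 2 * t (Suc i) - 1"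
        by (auto simp: a_def b_def)
      with 3 show ?thesis using dist_triangle[of "p (2 * t i)" "q (2 * t (Suc i) - 1)" "p 1"]
        by (simp add: joinpaths_def pq)
    qed
  qed
  have "(\<Sum>i<n. ennreal (dist ((p +++ q) (t i)) ((p +++ q) (t (Suc i)))))
     \<le> (\<Sum>i<n. ennreal (dist (p (a i)) (p (a (Suc i)))) + ennreal (dist (q (b i)) (q (b (Suc i)))))"
    by (intro sum_mono) (use le in \<open>auto simp flip: ennreal_plus intro!: ennreal_leI\<close>)
  also have "\<dots> = (\<Sum>i<n. ennreal (dist (p (a i)) (p (a (Suc i)))))
                + (\<Sum>i<n. ennreal (dist (q (b i)) (q (b (Suc i)))))"
    by (rule sum.distrib)
  also have "\<dots> \<le> curve_length p + curve_length q"
    by (intro add_mono curve_length_upper)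
       (use t in \<open>fastforce simp: a_def b_def mono_on_def image_subset_iff\<close>)+
  finally show "(\<Sum>i<n. ennreal (dist ((p +++ q) (t i)) ((p +++ q) (t (Suc i)))))
      \<le> curve_length p + curve_length q" .
qed

lemma intrinsic_edist_le:
  assumes "path p" "path_image p \<subseteq> S" "pathstart p = x" "pathfinish p = y"
  shows "intrinsic_edist S x y \<le> curve_length p"
  unfolding intrinsic_edist_def by (rule INF_lower) (use assms in auto)

lemma intrinsic_edist_less_iff:
  "intrinsic_edist S x y < L \<longleftrightarrow>
    (\<exists>p. path p \<and> path_image p \<subseteq> S \<and> pathstart p = x \<and> pathfinish p = y \<and> curve_length p < L)"
  unfolding intrinsic_edist_def INF_less_iff by auto

lemma dist_le_intrinsic_edist: "ennreal (dist x y) \<le> intrinsic_edist S x y"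
  unfolding intrinsic_edist_def by (rule INF_greatest) (use dist_le_curve_length in auto)

lemma intrinsic_edist_commute_le: "intrinsic_edist S x y \<le> intrinsic_edist S y x"
  unfolding intrinsic_edist_def[of S y x]
proof (rule INF_greatest, clarify)
  fix p assume "path p" "path_image p \<subseteq> S"
  then have "intrinsic_edist S (pathfinish p) (pathstart p) \<le> curve_length (reversepath p)"
    by (intro intrinsic_edist_le) auto
  then show "intrinsic_edist S (pathfinish p) (pathstart p) \<le> curve_length p"
    using curve_length_reversepath_le order_trans by blast
qed

lemma intrinsic_edist_commute: "intrinsic_edist S x y = intrinsic_edist S y x"
  by (intro antisym intrinsic_edist_commute_le)

lemma intrinsic_edist_triangle:
  "intrinsic_edist S x z \<le> intrinsic_edist S x y + intrinsic_edist S y z"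
proof (rule ccontr)
  assume "\<not> ?thesis"
  then have "intrinsic_edist S x y + intrinsic_edist S y z < intrinsic_edist S x z" by simp
  then obtain u v where uv: "intrinsic_edist S x y < u" "intrinsic_edist S y z < v"
      "u + v \<le> intrinsic_edist S x z"
  proof -
    assume *: "intrinsic_edist S x y + intrinsic_edist S y z < intrinsic_edist S x z"
    assume that: "\<And>u v. intrinsic_edist S x y < u \<Longrightarrow> intrinsic_edist S y z < v \<Longrightarrow>
      u + v \<le> intrinsic_edist S x z \<Longrightarrow> thesis"
    obtain m where m: "intrinsic_edist S x y + intrinsic_edist S y z < m" "m < intrinsic_edist S x z"
      using dense[OF *] by blast
    then obtain r where r: "m = ennreal r" "0 \<le> r" by (cases m) auto
    have fin: "intrinsic_edist S x y < top" "intrinsic_edist S y z < top"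
      using m(1) r by (auto simp: less_top[symmetric])
    then obtain A B where AB: "intrinsic_edist S x y = ennreal A" "0 \<le> A"
        "intrinsic_edist S y z = ennreal B" "0 \<le> B"
      by (cases "intrinsic_edist S x y"; cases "intrinsic_edist S y z") auto
    define e where "e = (r - A - B) / 2"
    have e: "e > 0" using m(1) r AB by (simp add: e_def ennreal_less_iff flip: ennreal_plus)
    have "ennreal (A + e) + ennreal (B + e) = m"
      using r AB e by (simp flip: ennreal_plus) (simp add: e_def field_simps)
    then show thesis
      by (intro that[of "ennreal (A + e)" "ennreal (B + e)"])
         (use AB e m(2) in \<open>auto simp: ennreal_less_iff\<close>)
  qed
  obtain p q where p: "path p" "path_image p \<subseteq> S" "pathstart p = x" "pathfinish p = y" "curve_length p < u"
    and q: "path q" "path_image q \<subseteq> S" "pathstart q = y" "pathfinish q = z" "curve_length q < v"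
    using uv(1,2) unfolding intrinsic_edist_less_iff by auto
  have "intrinsic_edist S x z \<le> curve_length (p +++ q)"
    by (rule intrinsic_edist_le) (use p q in \<open>auto simp: path_image_join\<close>)
  also have "\<dots> \<le> curve_length p + curve_length q"
    by (rule curve_length_joinpaths_le) (use p q in simp)
  also have "\<dots> < u + v" using p(5) q(5) by (rule add_strict_mono)
  also have "\<dots> \<le> intrinsic_edist S x z" by (rule uv(3))
  finally show False by simp
qed

lemma intrinsic_edist_segment:
  fixes x y :: "'a::real_normed_vector"
  assumes "closed_segment x y \<subseteq> S"
  shows "intrinsic_edist S x y = ennreal (dist x y)"
proof (rule antisym)
  have "intrinsic_edist S x y \<le> curve_length (linepath x y)"
    by (rule intrinsic_edist_le) (use assms in auto)
  then show "intrinsic_edist S x y \<le> ennreal (dist x y)"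
    using curve_length_linepath order_trans by blast
qed (rule dist_le_intrinsic_edist)

lemma Metric_space_intrinsic:
  assumes fin: "\<And>x y. x \<in> S \<Longrightarrow> y \<in> S \<Longrightarrow> intrinsic_edist S x y < top"
  shows "Metric_space S (\<lambda>x y. enn2real (intrinsic_edist S x y))"
proof
  fix x y z
  show "0 \<le> enn2real (intrinsic_edist S x y)" by simp
  show "enn2real (intrinsic_edist S x y) = enn2real (intrinsic_edist S y x)"
    by (simp add: intrinsic_edist_commute)
  assume x: "x \<in> S" and y: "y \<in> S"
  have "curve_length (\<lambda>_. x) \<le> 0"
    by (rule curve_length_least) simp
  moreover have "intrinsic_edist S x x \<le> curve_length (\<lambda>_. x)"
    by (rule intrinsic_edist_le)
       (use x in \<open>auto simp: path_def path_image_def pathstart_def pathfinish_def\<close>)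
  ultimately have "intrinsic_edist S x x = 0"
    by (metis le_zero_eq order_trans)
  moreover have "intrinsic_edist S x y = 0 \<Longrightarrow> x = y"
    using dist_le_intrinsic_edist[of x y S] by (simp add: ennreal_eq_0_iff)
  ultimately show "enn2real (intrinsic_edist S x y) = 0 \<longleftrightarrow> x = y"
    using fin[OF x y] by (auto simp: enn2real_eq_0_iff)
  assume z: "z \<in> S"
  have "enn2real (intrinsic_edist S x z) \<le> enn2real (intrinsic_edist S x y + intrinsic_edist S y z)"
    by (rule enn2real_mono[OF intrinsic_edist_triangle]) (use fin[OF x y] fin[OF y z] in simp)
  also have "\<dots> = enn2real (intrinsic_edist S x y) + enn2real (intrinsic_edist S y z)"
    by (rule enn2real_plus) (use fin[OF x y] fin[OF y z] in simp_all)
  finally show "enn2real (intrinsic_edist S x z)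
      \<le> enn2real (intrinsic_edist S x y) + enn2real (intrinsic_edist S y z)" .
qed

definition segJ :: "(real \<times> real) set" where
  "segJ = {(0, y) | y. -1 \<le> y \<and> y \<le> 1}"

definition segI :: "(real \<times> real) set" where
  "segI = {(x, 0) | x. 0 \<le> x \<and> x \<le> 1}"

text \<open>\<open>segIn n\<close> is meant for \<open>n \<ge> 1\<close>; by \<open>1 / 0 = 0\<close>, \<open>segIn 0\<close> is all of \<open>segI\<close>.\<close>

definition segIn :: "nat \<Rightarrow> (real \<times> real) set" where
  "segIn n = {(x, 0) | x. 1 / real n \<le> x \<and> x \<le> 1}"

definition triode :: "(real \<times> real) metric" where
  "triode = intrinsic_metric (segJ \<union> segI)"

definition cut_triode :: "nat \<Rightarrow> (real \<times> real) metric" where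
  "cut_triode n = submetric triode (segJ \<union> segIn n)"

lemma segIn_subset: "segIn n \<subseteq> segI"
proof -
  have "0 \<le> 1 / real n" by simp
  then show ?thesis unfolding segIn_def segI_def using order_trans by blast
qed

lemma Metric_space_triode:
  "Metric_space (segJ \<union> segI) (\<lambda>x y. enn2real (intrinsic_edist (segJ \<union> segI) x y))"
proof (rule Metric_space_intrinsic)
  let ?X = "segJ \<union> segI"
  have eq: "segJ = {0} \<times> {-1..1}" "segI = {0..1} \<times> {0}"
    by (auto simp: segJ_def segI_def)
  have cJ: "closed_segment (0, 0) x \<subseteq> segJ" if "x \<in> segJ" for x
    using that by (intro closed_segment_subset) (auto simp: eq intro!: convex_Times)
  have cI: "closed_segment (0, 0) x \<subseteq> segI" if "x \<in> segI" for x
    using that by (intro closed_segment_subset) (auto simp: eq intro!: convex_Times)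
  have o: "intrinsic_edist ?X (0, 0) x < top" if "x \<in> ?X" for x
  proof -
    have "closed_segment (0, 0) x \<subseteq> ?X" using that cJ[of x] cI[of x] by blast
    then show ?thesis by (simp add: intrinsic_edist_segment)
  qed
  fix x y assume "x \<in> ?X" "y \<in> ?X"
  then have "intrinsic_edist ?X x (0, 0) + intrinsic_edist ?X (0, 0) y < top"
    using o by (simp add: intrinsic_edist_commute[of _ x])
  then show "intrinsic_edist ?X x y < top"
    using intrinsic_edist_triangle le_less_trans by blast
qed

lemma mspace_triode: "mspace triode = segJ \<union> segI"
  and mdist_triode: "mdist triode x y = enn2real (intrinsic_edist (segJ \<union> segI) x y)"
  using Metric_space.mspace_metric[OF Metric_space_triode] Metric_space.mdist_metric[OF Metric_space_triode]
  by (simp_all add: triode_def intrinsic_metric_def)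

lemma mspace_cut_triode: "mspace (cut_triode n) = segJ \<union> segIn n"
  using segIn_subset[of n] by (auto simp: cut_triode_def mspace_triode)

lemma mdist_cut_triode: "mdist (cut_triode n) = mdist triode"
  by (simp add: cut_triode_def)

end

theory Submission
  imports Defs
begin

text \<open>
  Retracting the stem onto a shorter one gives the Cauchy property. Suppose \<open>Z\<close> were a limit, and
  let \<open>f\<^sub>n\<close>, \<open>g\<^sub>n\<close> be almost isometric maps between \<open>X\<^sub>n\<close> and \<open>Z\<close>. By connectedness and the mutual
  distances of the three tips, each \<open>g\<^sub>m \<circ> f\<^sub>n\<close> maps the bar \<open>J\<close> into \<open>J\<close> and the stem
  \<open>I\<^sub>n\<close> into \<open>I\<^sub>m\<close>. Fix a large \<open>M\<close>. The set \<open>f\<^sub>M(J)\<close> is compact and contained in the open set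
  \<open>g\<^sub>M\<^sup>-\<^sup>1(J)\<close>, hence so is its \<open>d\<close>-neighbourhood for some \<open>d > 0\<close>; this replaces completeness
  of \<open>Z\<close>. For large \<open>n\<close>, the intermediate value theorem gives \<open>z \<in> f\<^sub>M(J)\<close> with
  \<open>g\<^sub>n(z)\<close> equal to the branch point. So \<open>f\<^sub>n\<close> maps the lower end \<open>(1/n, 0)\<close> of the stem
  into the \<open>d\<close>-neighbourhood of \<open>z\<close>, although \<open>g\<^sub>M \<circ> f\<^sub>n\<close> maps it into \<open>I\<^sub>M\<close>.
\<close>

section \<open>The intrinsic metric of the triode in coordinates\<close>

text \<open>The branch point \<open>(0, 0)\<close> separates the bar from the stem. The two straight
  segments through it give the upper bound; conversely every path from \<open>p\<close> to
  \<open>q\<close> meets it, so the path is at least as long as the polygon through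
  \<open>p\<close>, \<open>(0, 0)\<close> and \<open>q\<close>.\<close>

lemma mdist_triode_mixed:
  assumes "p \<in> segJ" "q \<in> segI"
  shows "mdist triode p q = \<bar>snd p\<bar> + fst q"
proof -
  let ?S = "segJ \<union> segI"
  obtain y where p: "p = (0, y)" and y: "-1 \<le> y" "y \<le> 1" using assms by (auto simp: segJ_def)
  obtain x where q: "q = (x, 0)" and x: "0 \<le> x" "x \<le> 1" using assms by (auto simp: segI_def)
  have eq: "segJ = {0} \<times> {-1..1}" "segI = {0..1} \<times> {0}"
    by (auto simp: segJ_def segI_def)
  have s1: "closed_segment p (0, 0) \<subseteq> ?S"
    by (rule le_supI1, rule closed_segment_subset) (use p y in \<open>auto simp: eq intro!: convex_Times\<close>)
  have s2: "closed_segment (0, 0) q \<subseteq> ?S"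
    by (rule le_supI2, rule closed_segment_subset) (use q x in \<open>auto simp: eq intro!: convex_Times\<close>)
  have d: "dist p (0, 0) = \<bar>y\<bar>" "dist (0, 0) q = x"
    using x by (simp_all add: p q dist_Pair_Pair)
  have "intrinsic_edist ?S p q \<le> intrinsic_edist ?S p (0, 0) + intrinsic_edist ?S (0, 0) q"
    by (rule intrinsic_edist_triangle)
  also have "\<dots> = ennreal (\<bar>y\<bar> + x)"
    using s1 s2 x by (simp add: intrinsic_edist_segment d)
  finally have upper: "intrinsic_edist ?S p q \<le> ennreal (\<bar>y\<bar> + x)" .
  have lower: "ennreal (\<bar>y\<bar> + x) \<le> intrinsic_edist ?S p q"
    unfolding intrinsic_edist_def
  proof (rule INF_greatest, clarify)
    fix c :: "real \<Rightarrow> real \<times> real"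
    assume c: "path c" "path_image c \<subseteq> ?S" "p = pathstart c" "q = pathfinish c"
    have c01: "c 0 = p" "c 1 = q" using c by (auto simp: pathstart_def pathfinish_def)
    \<comment> \<open>On the triode this function is nonpositive on the bar, nonnegative on the
      stem, and zero only at the branch point, so a zero in \<open>t\<close> is a passage of
      \<open>c\<close> through \<open>(0, 0)\<close>.\<close>
    have "continuous_on {0..1} (\<lambda>t. fst (c t) - \<bar>snd (c t)\<bar>)"
      using c(1) by (auto simp: path_def intro!: continuous_intros)
    then obtain t where t: "0 \<le> t" "t \<le> 1" "fst (c t) - \<bar>snd (c t)\<bar> = 0"
      using IVT'[of "\<lambda>t. fst (c t) - \<bar>snd (c t)\<bar>" 0 0 1] x c01 p q by auto
    have "c t \<in> ?S" using c(2) t by (auto simp: path_image_def image_subset_iff)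
    then have ct: "c t = (0, 0)" using t(3) by (auto simp: segJ_def segI_def)
    define s where "s = (\<lambda>i::nat. if i = 0 then 0 else if i = 1 then t else 1)"
    have "(\<Sum>i<2. ennreal (dist (c (s i)) (c (s (Suc i))))) \<le> curve_length c"
      by (rule curve_length_upper) (use t in \<open>auto simp: s_def mono_on_def\<close>)
    then show "ennreal (\<bar>y\<bar> + x) \<le> curve_length c"
      using x by (simp add: s_def numeral_2_eq_2 c01 ct d)
  qed
  from upper lower have "intrinsic_edist ?S p q = ennreal (\<bar>y\<bar> + x)" by (rule antisym)
  then show ?thesis using x by (simp add: mdist_triode p q del: ennreal_plus)
qed

text \<open>Points on a common segment are joined by that axis-parallel segment, and the mixed case
  goes through the origin, so the intrinsic metric is the restricted l1 metric of the plane. All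
  later distance estimates thereby become linear arithmetic.\<close>

lemma mdist_triode_eq:
  assumes "p \<in> segJ \<union> segI" "q \<in> segJ \<union> segI"
  shows "mdist triode p q = \<bar>fst p - fst q\<bar> + \<bar>snd p - snd q\<bar>"
proof -
  have eq: "segJ = {0} \<times> {-1..1}" "segI = {0..1} \<times> {0}"
    by (auto simp: segJ_def segI_def)
  have conv: "convex segJ" "convex segI" by (auto simp: eq intro!: convex_Times)
  consider "p \<in> segJ" "q \<in> segJ" | "p \<in> segI" "q \<in> segI" | "p \<in> segJ" "q \<in> segI"
    | "q \<in> segJ" "p \<in> segI" using assms by blast
  then show ?thesis
  proof cases
    case 1
    then have "closed_segment p q \<subseteq> segJ \<union> segI"
      using closed_segment_subset[OF _ _ conv(1)] by blast
    with 1 show ?thesis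
      by (auto simp: mdist_triode intrinsic_edist_segment segJ_def dist_Pair_Pair dist_real_def)
  next
    case 2
    then have "closed_segment p q \<subseteq> segJ \<union> segI"
      using closed_segment_subset[OF _ _ conv(2)] by blast
    with 2 show ?thesis
      by (auto simp: mdist_triode intrinsic_edist_segment segI_def dist_Pair_Pair dist_real_def)
  next
    case 3
    then show ?thesis using mdist_triode_mixed[OF 3] by (auto simp: segJ_def segI_def)
  next
    case 4
    then show ?thesis using mdist_triode_mixed[OF 4]
      by (auto simp: segJ_def segI_def mdist_commute[of _ p])
  qed
qed

lemma mdist_cut_triode_eq:
  assumes "p \<in> mspace (cut_triode n)" "q \<in> mspace (cut_triode n)"
  shows "mdist (cut_triode n) p q = \<bar>fst p - fst q\<bar> + \<bar>snd p - snd q\<bar>"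
  using assms segIn_subset[of n] mdist_triode_eq[of p q]
  by (auto simp: mspace_cut_triode mdist_cut_triode)

section \<open>Passing between bounds on \<open>dcGH\<close> and pairs of maps\<close>

lemma dcGH_le:
  assumes "continuous_map (mtopology_of X) (mtopology_of Y) f"
    and "continuous_map (mtopology_of Y) (mtopology_of X) g"
    and "\<And>x x'. x \<in> mspace X \<Longrightarrow> x' \<in> mspace X \<Longrightarrow> \<bar>mdist X x x' - mdist Y (f x) (f x')\<bar> \<le> 2 * e"
    and "\<And>y y'. y \<in> mspace Y \<Longrightarrow> y' \<in> mspace Y \<Longrightarrow> \<bar>mdist Y y y' - mdist X (g y) (g y')\<bar> \<le> 2 * e"
    and "\<And>x y. x \<in> mspace X \<Longrightarrow> y \<in> mspace Y \<Longrightarrow> \<bar>mdist X x (g y) - mdist Y (f x) y\<bar> \<le> 2 * e"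
  shows "dcGH X Y \<le> ennreal e"
proof -
  have "dcGH X Y \<le> max (distortion X Y f) (max (distortion Y X g) (codistortion X Y f g)) / 2"
    unfolding dcGH_def by (intro divide_right_mono_ennreal INF_lower2[of "(f, g)"]) (use assms in auto)
  also have "\<dots> \<le> ennreal (2 * e) / 2"
    unfolding distortion_def codistortion_def
    by (intro divide_right_mono_ennreal max.boundedI SUP_least ennreal_leI) (use assms in auto)
  also have "\<dots> = ennreal e"
    by (cases "0 \<le> e") (simp_all add: ennreal_neg ennreal_divide_numeral)
  finally show ?thesis .
qed

text \<open>A strict bound on an infimum is realized by some pair of maps; the factor 2 undoes the
  one half in \<open>dcGH\<close>.\<close>

lemma dcGH_lessE:
  assumes "dcGH X Y < ennreal e"
  obtains f g where "continuous_map (mtopology_of X) (mtopology_of Y) f"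
    and "continuous_map (mtopology_of Y) (mtopology_of X) g"
    and "\<And>x x'. x \<in> mspace X \<Longrightarrow> x' \<in> mspace X \<Longrightarrow> \<bar>mdist X x x' - mdist Y (f x) (f x')\<bar> < 2 * e"
    and "\<And>y y'. y \<in> mspace Y \<Longrightarrow> y' \<in> mspace Y \<Longrightarrow> \<bar>mdist Y y y' - mdist X (g y) (g y')\<bar> < 2 * e"
    and "\<And>x y. x \<in> mspace X \<Longrightarrow> y \<in> mspace Y \<Longrightarrow> \<bar>mdist X x (g y) - mdist Y (f x) y\<bar> < 2 * e"
proof -
  have e: "0 \<le> e" using assms by (cases "0 \<le> e") (auto simp: ennreal_neg)
  let ?P = "\<lambda>(f, g). max (distortion X Y f) (max (distortion Y X g) (codistortion X Y f g))"
  let ?A = "{(f, g). continuous_map (mtopology_of X) (mtopology_of Y) f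
                          \<and> continuous_map (mtopology_of Y) (mtopology_of X) g}"
  have "(INF fg\<in>?A. ?P fg) < ennreal (2 * e)"
  proof (rule ccontr)
    assume "\<not> ?thesis"
    then have "ennreal (2 * e) / 2 \<le> (INF fg\<in>?A. ?P fg) / 2"
      by (intro divide_right_mono_ennreal) simp
    moreover have "ennreal (2 * e) / 2 = ennreal e"
      using e by (simp add: ennreal_divide_numeral)
    ultimately show False using assms unfolding dcGH_def by simp
  qed
  then obtain f g where fg: "continuous_map (mtopology_of X) (mtopology_of Y) f"
      "continuous_map (mtopology_of Y) (mtopology_of X) g"
      "distortion X Y f < ennreal (2 * e)" "distortion Y X g < ennreal (2 * e)"
      "codistortion X Y f g < ennreal (2 * e)"
    unfolding INF_less_iff by auto
  show thesis
  proof (rule that[OF fg(1,2)])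
    show "\<bar>mdist X x x' - mdist Y (f x) (f x')\<bar> < 2 * e" if "x \<in> mspace X" "x' \<in> mspace X" for x x'
    proof -
      have "ennreal \<bar>mdist X x x' - mdist Y (f x) (f x')\<bar> \<le> distortion X Y f"
        unfolding distortion_def using that by (intro SUP_upper2[of x] SUP_upper)
      from le_less_trans[OF this fg(3)] show ?thesis by (simp add: ennreal_less_iff)
    qed
    show "\<bar>mdist Y x x' - mdist X (g x) (g x')\<bar> < 2 * e" if "x \<in> mspace Y" "x' \<in> mspace Y" for x x'
    proof -
      have "ennreal \<bar>mdist Y x x' - mdist X (g x) (g x')\<bar> \<le> distortion Y X g"
        unfolding distortion_def using that by (intro SUP_upper2[of x] SUP_upper)
      from le_less_trans[OF this fg(4)] show ?thesis by (simp add: ennreal_less_iff)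
    qed
    show "\<bar>mdist X x (g y) - mdist Y (f x) y\<bar> < 2 * e" if "x \<in> mspace X" "y \<in> mspace Y" for x y
    proof -
      have "ennreal \<bar>mdist X x (g y) - mdist Y (f x) y\<bar> \<le> codistortion X Y f g"
        unfolding codistortion_def using that by (intro SUP_upper2[of x] SUP_upper)
      from le_less_trans[OF this fg(5)] show ?thesis by (simp add: ennreal_less_iff)
    qed
  qed
qed

section \<open>The Cauchy property\<close>

text \<open>For \<open>m\<close> and \<open>n\<close> at least 1, this one formula restricts on
  \<open>cut_triode m\<close> to the retraction onto \<open>cut_triode n\<close> if
  \<open>n \<le> m\<close>, and to the inclusion if \<open>m \<le> n\<close>. On the whole triode it
  would tear at the branch point.\<close>

definition clamp_stem :: "nat \<Rightarrow> real \<times> real \<Rightarrow> real \<times> real" where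
  "clamp_stem n p = (if fst p = 0 then p else (max (fst p) (1 / real n), snd p))"

lemma clamp_stem_in:
  assumes "p \<in> mspace (cut_triode m)" "1 \<le> n"
  shows "clamp_stem n p \<in> mspace (cut_triode n)"
  using assms by (auto simp: clamp_stem_def mspace_cut_triode segJ_def segIn_def max_def)

text \<open>The tear at the branch point does no harm, since bar and stem of
  \<open>cut_triode m\<close> are at distance \<open>1 / real m\<close>. This makes the map
  Lipschitz with constant \<open>real m\<close>.\<close>

lemma continuous_map_clamp_stem:
  assumes "1 \<le> m" "1 \<le> n"
  shows "continuous_map (mtopology_of (cut_triode m)) (mtopology_of (cut_triode n)) (clamp_stem n)"
proof (rule Lipschitz_continuous_imp_continuous_map)
  have "mdist (cut_triode n) (clamp_stem n p) (clamp_stem n q) \<le> real m * mdist (cut_triode m) p q"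
    if pq: "p \<in> mspace (cut_triode m)" "q \<in> mspace (cut_triode m)" for p q
  proof -
    have lin: "a \<le> real m * a" if "0 \<le> a" for a :: real
      using mult_right_mono[of 1 "real m" a] assms that by simp
    \<comment> \<open>A stem point has \<open>real m * a\<close> at least 1, which absorbs the lift
      to \<open>1 / real n\<close>.\<close>
    have stem: "max a (1 / real n) \<le> real m * a" if "1 / real m \<le> a" for a :: real
    proof -
      have "1 / real n \<le> 1" using assms by simp
      also have "1 \<le> real m * a" using that assms by (simp add: field_simps)
      finally have "1 / real n \<le> real m * a" .
      moreover have "0 \<le> a" using that order_trans[of 0 "1 / real m" a] by simp
      ultimately show ?thesis using lin[of a] by simp
    qed
    have pos: "0 < 1 / real m" using assms by simp
    have mx: "\<bar>max a c - max b c\<bar> \<le> real m * \<bar>a - b\<bar>" for a b c :: real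
      using lin[of "\<bar>a - b\<bar>"] by linarith
    have "\<bar>fst (clamp_stem n p) - fst (clamp_stem n q)\<bar> + \<bar>snd (clamp_stem n p) - snd (clamp_stem n q)\<bar>
        \<le> real m * (\<bar>fst p - fst q\<bar> + \<bar>snd p - snd q\<bar>)"
    proof -
      consider "p \<in> segJ" "q \<in> segJ" | "p \<in> segIn m" "q \<in> segIn m" | "p \<in> segJ" "q \<in> segIn m"
        | "p \<in> segIn m" "q \<in> segJ" using pq by (auto simp: mspace_cut_triode)
      then show ?thesis
      proof cases
        case 1
        then show ?thesis using lin[of "\<bar>snd p - snd q\<bar>"] by (auto simp: segJ_def clamp_stem_def)
      next
        case 2
        then have "fst p \<noteq> 0" "fst q \<noteq> 0" "snd p = 0" "snd q = 0" using pos by (auto simp: segIn_def)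
        then show ?thesis using mx by (simp add: clamp_stem_def)
      next
        case 3
        then have "fst p = 0" "fst q \<noteq> 0" "snd q = 0" "1 / real m \<le> fst q"
          using pos by (auto simp: segJ_def segIn_def)
        then have "clamp_stem n p = p" "clamp_stem n q = (max (fst q) (1 / real n), 0)"
          "\<bar>fst p - fst q\<bar> = fst q" "\<bar>snd p - snd q\<bar> = \<bar>snd p\<bar>" "fst p = 0" "0 < fst q"
          using less_le_trans[OF pos, of "fst q"] by (simp_all add: clamp_stem_def)
        moreover have "max (fst q) (1 / real n) + \<bar>snd p\<bar> \<le> real m * (fst q + \<bar>snd p\<bar>)"
          unfolding distrib_left using \<open>1 / real m \<le> fst q\<close> by (intro add_mono stem lin) simp_all
        ultimately show ?thesis by simp
      next
        case 4
        then have "fst q = 0" "fst p \<noteq> 0" "snd p = 0" "1 / real m \<le> fst p"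
          using pos by (auto simp: segJ_def segIn_def)
        then have "clamp_stem n q = q" "clamp_stem n p = (max (fst p) (1 / real n), 0)"
          "\<bar>fst p - fst q\<bar> = fst p" "\<bar>snd p - snd q\<bar> = \<bar>snd q\<bar>" "fst q = 0" "0 < fst p"
          using less_le_trans[OF pos, of "fst p"] by (simp_all add: clamp_stem_def)
        moreover have "max (fst p) (1 / real n) + \<bar>snd q\<bar> \<le> real m * (fst p + \<bar>snd q\<bar>)"
          unfolding distrib_left using \<open>1 / real m \<le> fst p\<close> by (intro add_mono stem lin) simp_all
        ultimately show ?thesis by simp
      qed
    qed
    then show ?thesis
      using pq assms by (simp add: mdist_cut_triode_eq clamp_stem_in)
  qed
  then show "Lipschitz_continuous_map (cut_triode m) (cut_triode n) (clamp_stem n)"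
    using clamp_stem_in assms unfolding Lipschitz_continuous_map_def by blast
qed

lemma clamp_stem_close:
  assumes "p \<in> mspace (cut_triode m)" "1 \<le> n"
  shows "snd (clamp_stem n p) = snd p" "\<bar>fst (clamp_stem n p) - fst p\<bar> \<le> 1 / real n"
proof -
  have "0 \<le> fst p" using assms segIn_subset[of m]
    by (auto simp: mspace_cut_triode segJ_def segI_def)
  then show "snd (clamp_stem n p) = snd p" "\<bar>fst (clamp_stem n p) - fst p\<bar> \<le> 1 / real n"
    by (auto simp: clamp_stem_def max_def)
qed

text \<open>Both maps move points horizontally by at most \<open>1 / real N\<close>. Each of the
  three quantities compares distances after at most two such moves, hence is at most
  \<open>2 / real N\<close>, which \<open>dcGH\<close> halves.\<close>

lemma dcGH_cut_triode_le:
  assumes "1 \<le> N" "N \<le> m" "N \<le> n"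
  shows "dcGH (cut_triode m) (cut_triode n) \<le> ennreal (1 / real N)"
proof (rule dcGH_le[where f = "clamp_stem n" and g = "clamp_stem m"])
  have bounds: "1 / real m \<le> 1 / real N" "1 / real n \<le> 1 / real N" "1 \<le> m" "1 \<le> n"
    using assms by (auto intro!: divide_left_mono)
  show "continuous_map (mtopology_of (cut_triode m)) (mtopology_of (cut_triode n)) (clamp_stem n)"
    "continuous_map (mtopology_of (cut_triode n)) (mtopology_of (cut_triode m)) (clamp_stem m)"
    using bounds by (auto intro: continuous_map_clamp_stem)
  note close_m = clamp_stem_close[OF _ bounds(3)] clamp_stem_in[OF _ bounds(3)]
  note close_n = clamp_stem_close[OF _ bounds(4)] clamp_stem_in[OF _ bounds(4)]
  show "\<bar>mdist (cut_triode m) x x' - mdist (cut_triode n) (clamp_stem n x) (clamp_stem n x')\<bar> \<le> 2 * (1 / real N)"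
    if "x \<in> mspace (cut_triode m)" "x' \<in> mspace (cut_triode m)" for x x'
    using close_n[OF that(1)] close_n[OF that(2)] bounds that by (simp only: mdist_cut_triode_eq; linarith)
  show "\<bar>mdist (cut_triode n) x x' - mdist (cut_triode m) (clamp_stem m x) (clamp_stem m x')\<bar> \<le> 2 * (1 / real N)"
    if "x \<in> mspace (cut_triode n)" "x' \<in> mspace (cut_triode n)" for x x'
    using close_m[OF that(1)] close_m[OF that(2)] bounds that by (simp only: mdist_cut_triode_eq; linarith)
  show "\<bar>mdist (cut_triode m) x (clamp_stem m y) - mdist (cut_triode n) (clamp_stem n x) y\<bar> \<le> 2 * (1 / real N)"
    if "x \<in> mspace (cut_triode m)" "y \<in> mspace (cut_triode n)" for x y
    using close_n[OF that(1)] close_m[OF that(2)] bounds that by (simp only: mdist_cut_triode_eq; linarith)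
qed

section \<open>Continuous maps into a cut triode\<close>

lemma continuous_map_mtopology_of_delta:
  assumes "continuous_map (mtopology_of X) (mtopology_of Y) f" "x \<in> mspace X" "0 < e"
  obtains d where "0 < d" "\<And>x'. x' \<in> mspace X \<Longrightarrow> mdist X x x' < d \<Longrightarrow> mdist Y (f x) (f x') < e"
  using assms
    Metric_space.metric_continuous_map[OF Metric_space_mspace_mdist[of X] Metric_space_mspace_mdist[of Y], of f]
  unfolding mtopology_of_def by metis

lemma cut_triode_cases:
  assumes "p \<in> mspace (cut_triode n)"
  obtains "fst p = 0" "-1 \<le> snd p" "snd p \<le> 1" | "snd p = 0" "1 / real n \<le> fst p" "fst p \<le> 1"
  using assms by (auto simp: mspace_cut_triode segJ_def segIn_def)

lemma cut_triode_gap: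
  assumes "p \<in> mspace (cut_triode n)" "fst p < 1 / real n"
  shows "fst p = 0"
  using assms by (auto elim: cut_triode_cases)

lemma bar_in_cut_triode: "(0, s) \<in> mspace (cut_triode n)" if "s \<in> {-1..1}"
  using that by (auto simp: mspace_cut_triode segJ_def)

lemma stem_in_cut_triode: "(s, 0) \<in> mspace (cut_triode n)" if "s \<in> {1 / real n..1}"
  using that by (auto simp: mspace_cut_triode segIn_def)

text \<open>Each coordinate difference is dominated by the l1 distance. With a 1-Lipschitz curve
  \<gamma> this turns continuity between abstract metric spaces into continuity of real functions,
  for which connectedness and the intermediate value theorem are at hand.\<close>

lemma continuous_on_cut_triode_coords:
  fixes \<gamma> :: "real \<Rightarrow> 'a"
  assumes "continuous_map (mtopology_of X) (mtopology_of (cut_triode n)) h"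
    and "\<And>s. s \<in> S \<Longrightarrow> \<gamma> s \<in> mspace X"
    and "\<And>s t. s \<in> S \<Longrightarrow> t \<in> S \<Longrightarrow> mdist X (\<gamma> s) (\<gamma> t) \<le> \<bar>s - t\<bar>"
  shows "continuous_on S (\<lambda>s. fst (h (\<gamma> s)))" "continuous_on S (\<lambda>s. snd (h (\<gamma> s)))"
proof -
  have h: "h x \<in> mspace (cut_triode n)" if "x \<in> mspace X" for x
    using continuous_map_image_subset_topspace[OF assms(1)] that by auto
  have "\<exists>d>0. \<forall>t\<in>S. dist t s < d \<longrightarrow>
      dist (fst (h (\<gamma> t))) (fst (h (\<gamma> s))) < e \<and> dist (snd (h (\<gamma> t))) (snd (h (\<gamma> s))) < e"
    if s: "s \<in> S" and e: "0 < e" for s e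
  proof -
    obtain d where d: "0 < d"
      "\<And>x'. x' \<in> mspace X \<Longrightarrow> mdist X (\<gamma> s) x' < d \<Longrightarrow> mdist (cut_triode n) (h (\<gamma> s)) (h x') < e"
      using continuous_map_mtopology_of_delta[OF assms(1) assms(2)[OF s] e] by blast
    have "dist (fst (h (\<gamma> t))) (fst (h (\<gamma> s))) < e \<and> dist (snd (h (\<gamma> t))) (snd (h (\<gamma> s))) < e"
      if t: "t \<in> S" "dist t s < d" for t
    proof -
      have "mdist (cut_triode n) (h (\<gamma> s)) (h (\<gamma> t)) < e"
        using assms(3)[OF s t(1)] t by (intro d(2) assms(2)) (auto simp: dist_real_def)
      then show ?thesis
        using assms(2) s t by (simp add: mdist_cut_triode_eq h dist_real_def; linarith)
    qed
    with d(1) show ?thesis by blast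
  qed
  then show "continuous_on S (\<lambda>s. fst (h (\<gamma> s)))" "continuous_on S (\<lambda>s. snd (h (\<gamma> s)))"
    unfolding continuous_on_iff by meson+
qed

text \<open>The first coordinate along the curve has a connected range. Containing 0 and a value at
  least \<open>1 / real n\<close>, it would contain \<open>1 / (2 * real n)\<close>, which lies in
  the gap excluded by \<open>cut_triode_gap\<close>.\<close>

lemma connected_path_same_component:
  fixes \<gamma> :: "real \<Rightarrow> 'a"
  assumes "1 \<le> n"
    and h: "continuous_map (mtopology_of X) (mtopology_of (cut_triode n)) h"
    and \<gamma>: "\<And>s. s \<in> S \<Longrightarrow> \<gamma> s \<in> mspace X"
      "\<And>s t. s \<in> S \<Longrightarrow> t \<in> S \<Longrightarrow> mdist X (\<gamma> s) (\<gamma> t) \<le> \<bar>s - t\<bar>"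
    and S: "connected S" "s \<in> S" "t \<in> S"
    and "fst (h (\<gamma> s)) = 0"
  shows "fst (h (\<gamma> t)) = 0"
proof (rule ccontr)
  assume ne: "fst (h (\<gamma> t)) \<noteq> 0"
  have h_in: "h (\<gamma> r) \<in> mspace (cut_triode n)" if "r \<in> S" for r
    using continuous_map_image_subset_topspace[OF h] \<gamma>(1)[OF that] by auto
  let ?u = "\<lambda>s. fst (h (\<gamma> s))"
  have "connected (?u ` S)"
    using continuous_on_cut_triode_coords(1)[OF h \<gamma>] S(1) by (rule connected_continuous_image)
  moreover have "1 / real n \<le> ?u t" using ne cut_triode_gap[OF h_in[OF S(3)]] by force
  moreover have "0 < 1 / real n" using assms(1) by simp
  ultimately have "1 / (2 * real n) \<in> ?u ` S"
    using S assms(8) connectedD_interval[of "?u ` S" 0 "?u t" "1 / (2 * real n)"]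
    by (force simp: field_simps)
  then obtain r where r: "r \<in> S" "?u r = 1 / (2 * real n)" by auto
  then show False using cut_triode_gap[OF h_in[OF r(1)]] assms(1) by (simp add: field_simps)
qed

text \<open>The tips \<open>(0, 1)\<close>, \<open>(0, -1)\<close> and \<open>(1, 0)\<close> are at
  mutual distance 2, so their images are more than \<open>3 / 2\<close> apart. This decides which
  component receives each tip, and connectedness extends the decision to the whole bar and the whole
  stem.\<close>

lemma near_isometry_cut_triode:
  assumes "1 \<le> m" "1 \<le> n"
    and h: "continuous_map (mtopology_of (cut_triode m)) (mtopology_of (cut_triode n)) h"
    and dis: "\<And>x x'. x \<in> mspace (cut_triode m) \<Longrightarrow> x' \<in> mspace (cut_triode m) \<Longrightarrow>
      \<bar>mdist (cut_triode m) x x' - mdist (cut_triode n) (h x) (h x')\<bar> < 1 / 2"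
  shows "\<And>s. s \<in> {-1..1} \<Longrightarrow> fst (h (0, s)) = 0"
    and "\<And>s. s \<in> {1 / real m..1} \<Longrightarrow> fst (h (s, 0)) \<noteq> 0"
    and "snd (h (0, 1)) * snd (h (0, -1)) < 0"
proof -
  have h_in: "h x \<in> mspace (cut_triode n)" if "x \<in> mspace (cut_triode m)" for x
    using continuous_map_image_subset_topspace[OF h] that by auto
  have m: "1 / real m \<le> 1" using assms by simp
  let ?a = "(0, 1)" and ?b = "(0, -1)" and ?c = "(1, 0) :: real \<times> real"
  have abc: "?a \<in> mspace (cut_triode m)" "?b \<in> mspace (cut_triode m)" "?c \<in> mspace (cut_triode m)"
    using m by (simp_all add: bar_in_cut_triode stem_in_cut_triode)
  have pair: "\<bar>fst (h p) - fst (h q)\<bar> + \<bar>snd (h p) - snd (h q)\<bar> > 3 / 2"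
    if "p \<in> mspace (cut_triode m)" "q \<in> mspace (cut_triode m)" "mdist (cut_triode m) p q = 2" for p q
    using dis[OF that(1,2)] that(3) mdist_cut_triode_eq[OF h_in[OF that(1)] h_in[OF that(2)]] by linarith
  have far: "\<bar>fst (h ?a) - fst (h ?b)\<bar> + \<bar>snd (h ?a) - snd (h ?b)\<bar> > 3 / 2"
    "\<bar>fst (h ?a) - fst (h ?c)\<bar> + \<bar>snd (h ?a) - snd (h ?c)\<bar> > 3 / 2"
    "\<bar>fst (h ?b) - fst (h ?c)\<bar> + \<bar>snd (h ?b) - snd (h ?c)\<bar> > 3 / 2"
    using pair[OF abc(1,2)] pair[OF abc(1,3)] pair[OF abc(2,3)] abc
    by (simp_all add: mdist_cut_triode_eq)
  have bar: "fst (h (0, t)) = 0" if "fst (h (0, s)) = 0" "s \<in> {-1..1}" "t \<in> {-1..1}" for s t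
    by (rule connected_path_same_component[OF assms(2) h, where S = "{-1..1}" and \<gamma> = "\<lambda>s. (0, s)" and s = s])
       (use that in \<open>auto simp: mdist_cut_triode_eq bar_in_cut_triode\<close>)
  have stem: "fst (h (t, 0)) = 0"
    if "fst (h (s, 0)) = 0" "s \<in> {1 / real m..1}" "t \<in> {1 / real m..1}" for s t
    by (rule connected_path_same_component[OF assms(2) h, where S = "{1 / real m..1}" and \<gamma> = "\<lambda>s. (s, 0)" and s = s])
       (use that in \<open>auto simp: mdist_cut_triode_eq stem_in_cut_triode\<close>)
  \<comment> \<open>Otherwise both ends of the bar land in the stem, where distances are at most
    1.\<close>
  have a0: "fst (h ?a) = 0"
  proof (rule ccontr)
    assume *: "fst (h ?a) \<noteq> 0"
    then have "fst (h ?b) \<noteq> 0" using bar[of "-1" 1] by auto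
    with * have "snd (h ?a) = 0" "snd (h ?b) = 0"
      using h_in[OF abc(1)] h_in[OF abc(2)] by (auto elim!: cut_triode_cases)
    moreover have "fst (h ?a) \<in> {0..1}" "fst (h ?b) \<in> {0..1}"
      using h_in[OF abc(1)] h_in[OF abc(2)] segIn_subset[of n]
      by (auto simp: mspace_cut_triode segJ_def segI_def)
    ultimately show False using far(1) by (simp; linarith)
  qed
  then have b0: "fst (h ?b) = 0" using bar[of 1 "-1"] by simp
  have ab: "\<bar>snd (h ?a)\<bar> \<le> 1" "\<bar>snd (h ?b)\<bar> \<le> 1"
    using h_in[OF abc(1)] h_in[OF abc(2)] by (auto elim!: cut_triode_cases)
  show "fst (h (0, s)) = 0" if "s \<in> {-1..1}" for s using bar[OF a0 _ that] by simp
  \<comment> \<open>Two points of [-1, 1] more than \<open>3 / 2\<close> apart have opposite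
    signs.\<close>
  have "snd (h ?a) > 0 \<and> snd (h ?b) < 0 \<or> snd (h ?a) < 0 \<and> snd (h ?b) > 0"
    using ab far(1) a0 b0 by (simp; arith)
  then show "snd (h ?a) * snd (h ?b) < 0" by (auto simp: mult_less_0_iff)
  \<comment> \<open>An interval of length 2 cannot hold three points pairwise more than
    \<open>3 / 2\<close> apart.\<close>
  have c0: "fst (h ?c) \<noteq> 0"
  proof
    assume *: "fst (h ?c) = 0"
    then have "\<bar>snd (h ?c)\<bar> \<le> 1" using h_in[OF abc(3)] by (auto elim!: cut_triode_cases)
    with far a0 b0 * ab show False by (simp; arith)
  qed
  show "fst (h (s, 0)) \<noteq> 0" if "s \<in> {1 / real m..1}" for s
    using stem[OF _ that, of 1] c0 m by auto
qed

section \<open>Nonexistence of a limit\<close>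

text \<open>The bar is open in \<open>cut_triode n\<close>, so its preimage under \<open>g\<close>
  is an open set around the compact image of the bar under \<open>f\<close>. The argument is
  sequential: a convergent subsequence is extracted from the parameters in [-1, 1], so that
  compactness is invoked only there and not in \<open>Z\<close>.\<close>

lemma bar_preimage_uniform_nbhd:
  assumes "1 \<le> n"
    and f: "continuous_map (mtopology_of (cut_triode m)) (mtopology_of Z) f"
    and g: "continuous_map (mtopology_of Z) (mtopology_of (cut_triode n)) g"
    and bar: "\<And>s. s \<in> {-1..1} \<Longrightarrow> fst (g (f (0, s))) = 0"
  obtains d where "0 < d" "\<And>s w. s \<in> {-1..1} \<Longrightarrow> w \<in> mspace Z \<Longrightarrow>
    mdist Z (f (0, s)) w < d \<Longrightarrow> fst (g w) = 0"
proof (rule ccontr)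
  assume contra: "\<not> thesis"
  have "\<exists>s w. s \<in> {-1..1} \<and> w \<in> mspace Z \<and> mdist Z (f (0, s)) w < inverse (real (Suc k)) \<and> fst (g w) \<noteq> 0" for k
    using contra that[of "inverse (real (Suc k))"] by fastforce
  then obtain s w where sw: "\<And>k. s k \<in> {-1..1}" "\<And>k. w k \<in> mspace Z"
    "\<And>k. mdist Z (f (0, s k)) (w k) < inverse (real (Suc k))" "\<And>k. fst (g (w k)) \<noteq> 0"
    by metis
  have f_in: "f (0, t) \<in> mspace Z" if "t \<in> {-1..1}" for t
    using continuous_map_image_subset_topspace[OF f] bar_in_cut_triode[OF that, of m] by auto
  have g_in: "g z \<in> mspace (cut_triode n)" if "z \<in> mspace Z" for z
    using continuous_map_image_subset_topspace[OF g] that by auto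
  obtain l r where l: "l \<in> {-1..1}" "strict_mono r" "(s \<circ> r) \<longlonglongrightarrow> l"
    using compact_Icc[of "-1::real" 1] sw(1) unfolding compact_def by metis
  \<comment> \<open>The tolerance is the width of the gap: a point of \<open>cut_triode n\<close>
    closer than \<open>1 / real n\<close> to a bar point is itself in the bar.\<close>
  obtain d where d: "0 < d" "\<And>z. z \<in> mspace Z \<Longrightarrow> mdist Z (f (0, l)) z < d \<Longrightarrow>
      mdist (cut_triode n) (g (f (0, l))) (g z) < 1 / real n"
    using continuous_map_mtopology_of_delta[OF g f_in[OF l(1)], of "1 / real n"] assms(1) by auto
  obtain d' where d': "0 < d'" "\<And>x. x \<in> mspace (cut_triode m) \<Longrightarrow>
      mdist (cut_triode m) (0, l) x < d' \<Longrightarrow> mdist Z (f (0, l)) (f x) < d / 2"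
    using continuous_map_mtopology_of_delta[OF f bar_in_cut_triode[OF l(1)], of "d / 2"] d(1) by auto
  have "\<forall>\<^sub>F k in sequentially. dist (s (r k)) l < d'"
    using tendstoD[OF l(3) d'(1)] by simp
  moreover have "\<forall>\<^sub>F k in sequentially. inverse (real (Suc k)) < d / 2"
    using order_tendstoD(2)[OF LIMSEQ_inverse_real_of_nat, of "d / 2"] d(1) by simp
  ultimately obtain k where k: "dist (s (r k)) l < d'" "inverse (real (Suc k)) < d / 2"
    using eventually_happens[OF eventually_conj] by force
  let ?s = "s (r k)" and ?w = "w (r k)"
  have "mdist (cut_triode m) (0, l) (0, ?s) < d'"
    using k(1) l(1) sw(1) by (simp add: mdist_cut_triode_eq bar_in_cut_triode dist_real_def)
  then have "mdist Z (f (0, l)) (f (0, ?s)) < d / 2"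
    using d'(2) bar_in_cut_triode sw(1) by blast
  moreover have "mdist Z (f (0, ?s)) ?w < d / 2"
  proof -
    have "inverse (real (Suc (r k))) \<le> inverse (real (Suc k))"
      using seq_suble[OF l(2), of k] by (intro le_imp_inverse_le) auto
    with sw(3)[of "r k"] k(2) show ?thesis by linarith
  qed
  moreover have "mdist Z (f (0, l)) ?w \<le> mdist Z (f (0, l)) (f (0, ?s)) + mdist Z (f (0, ?s)) ?w"
    using f_in l(1) sw by (intro mdist_triangle) auto
  ultimately have "mdist (cut_triode n) (g (f (0, l))) (g ?w) < 1 / real n"
    using sw(2) by (intro d(2)) auto
  then have "fst (g ?w) < 1 / real n"
    using f_in l(1) sw(2) bar[OF l(1)] by (simp add: mdist_cut_triode_eq g_in)
  then have "fst (g ?w) = 0" using cut_triode_gap[OF g_in] sw(2) by blast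
  with sw(4) show False by simp
qed

lemma cut_triode_no_limit:
  fixes Z :: "'a metric"
  shows "\<not> (\<lambda>n. dcGH (cut_triode n) Z) \<longlonglongrightarrow> 0"
proof
  assume lim: "(\<lambda>n. dcGH (cut_triode n) Z) \<longlonglongrightarrow> 0"
  \<comment> \<open>The condition \<open>1 \<le> n\<close> discards index 0, where
    \<open>1 / 0 = 0\<close> would leave no gap.\<close>
  have ev: "\<forall>\<^sub>F n in sequentially. 1 \<le> n \<and> dcGH (cut_triode n) Z < ennreal e" if "0 < e" for e
    using order_tendstoD(2)[OF lim, of "ennreal e"] that
    by (intro eventually_conj eventually_ge_at_top) simp
  \<comment> \<open>With \<open>1 / 8\<close>, each map distorts by less than \<open>1 / 4\<close>,
    so a composite of two stays below the \<open>1 / 2\<close> required by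
    \<open>near_isometry_cut_triode\<close>.\<close>
  obtain M where M: "1 \<le> M" "dcGH (cut_triode M) Z < ennreal (1 / 8)"
    using eventually_happens[OF ev[of "1/8"]] by auto
  obtain f g where f: "continuous_map (mtopology_of (cut_triode M)) (mtopology_of Z) f"
    and g: "continuous_map (mtopology_of Z) (mtopology_of (cut_triode M)) g"
    and dis_f: "\<And>x x'. x \<in> mspace (cut_triode M) \<Longrightarrow> x' \<in> mspace (cut_triode M) \<Longrightarrow>
      \<bar>mdist (cut_triode M) x x' - mdist Z (f x) (f x')\<bar> < 2 * (1 / 8)"
    and dis_g: "\<And>y y'. y \<in> mspace Z \<Longrightarrow> y' \<in> mspace Z \<Longrightarrow>
      \<bar>mdist Z y y' - mdist (cut_triode M) (g y) (g y')\<bar> < 2 * (1 / 8)"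
    using dcGH_lessE[OF M(2)] by metis
  have f_in: "f x \<in> mspace Z" if "x \<in> mspace (cut_triode M)" for x
    using continuous_map_image_subset_topspace[OF f] that by auto
  have gf: "continuous_map (mtopology_of (cut_triode M)) (mtopology_of (cut_triode M)) (\<lambda>x. g (f x))"
    using continuous_map_compose[OF f g] by (simp add: comp_def)
  have "\<bar>mdist (cut_triode M) x x' - mdist (cut_triode M) (g (f x)) (g (f x'))\<bar> < 1 / 2"
    if "x \<in> mspace (cut_triode M)" "x' \<in> mspace (cut_triode M)" for x x'
    using dis_f[OF that] dis_g[OF f_in[OF that(1)] f_in[OF that(2)]] by linarith
  note bar = near_isometry_cut_triode(1)[OF M(1) M(1) gf this]
  obtain d where d: "0 < d" "\<And>s w. s \<in> {-1..1} \<Longrightarrow> w \<in> mspace Z \<Longrightarrow>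
      mdist Z (f (0, s)) w < d \<Longrightarrow> fst (g w) = 0"
    using bar_preimage_uniform_nbhd[OF M(1) f g bar] by blast
  \<comment> \<open>The first bound again serves the composites; the second, together with
    \<open>1 / real n < d / 4\<close>, keeps the final sum \<open>4 * e + 1 / real n\<close> below
    \<open>d\<close>.\<close>
  define e where "e = min (1 / 8) (d / 8)"
  have e: "0 < e" "e \<le> 1 / 8" "e \<le> d / 8" using d(1) by (auto simp: e_def)
  have "\<forall>\<^sub>F n in sequentially. 1 / real n < d / 4"
    using order_tendstoD(2)[OF lim_1_over_n, of "d / 4"] d(1) by simp
  then obtain n where n: "1 \<le> n" "dcGH (cut_triode n) Z < ennreal e" "1 / real n < d / 4"
    using eventually_happens[OF eventually_conj[OF ev[OF e(1)]]] by force
  obtain f' g' where f': "continuous_map (mtopology_of (cut_triode n)) (mtopology_of Z) f'"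
    and g': "continuous_map (mtopology_of Z) (mtopology_of (cut_triode n)) g'"
    and dis_f': "\<And>x x'. x \<in> mspace (cut_triode n) \<Longrightarrow> x' \<in> mspace (cut_triode n) \<Longrightarrow>
      \<bar>mdist (cut_triode n) x x' - mdist Z (f' x) (f' x')\<bar> < 2 * e"
    and dis_g': "\<And>y y'. y \<in> mspace Z \<Longrightarrow> y' \<in> mspace Z \<Longrightarrow>
      \<bar>mdist Z y y' - mdist (cut_triode n) (g' y) (g' y')\<bar> < 2 * e"
    and codis': "\<And>x y. x \<in> mspace (cut_triode n) \<Longrightarrow> y \<in> mspace Z \<Longrightarrow>
      \<bar>mdist (cut_triode n) x (g' y) - mdist Z (f' x) y\<bar> < 2 * e"
    using dcGH_lessE[OF n(2)] by metis
  have f'_in: "f' x \<in> mspace Z" if "x \<in> mspace (cut_triode n)" for x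
    using continuous_map_image_subset_topspace[OF f'] that by auto
  have gf': "continuous_map (mtopology_of (cut_triode n)) (mtopology_of (cut_triode M)) (\<lambda>x. g (f' x))"
    using continuous_map_compose[OF f' g] by (simp add: comp_def)
  have "\<bar>mdist (cut_triode n) x x' - mdist (cut_triode M) (g (f' x)) (g (f' x'))\<bar> < 1 / 2"
    if "x \<in> mspace (cut_triode n)" "x' \<in> mspace (cut_triode n)" for x x'
    using dis_f'[OF that] dis_g[OF f'_in[OF that(1)] f'_in[OF that(2)]] e by linarith
  note stem = near_isometry_cut_triode(2)[OF n(1) M(1) gf' this]
  have g'f: "continuous_map (mtopology_of (cut_triode M)) (mtopology_of (cut_triode n)) (\<lambda>x. g' (f x))"
    using continuous_map_compose[OF f g'] by (simp add: comp_def)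
  have "\<bar>mdist (cut_triode M) x x' - mdist (cut_triode n) (g' (f x)) (g' (f x'))\<bar> < 1 / 2"
    if "x \<in> mspace (cut_triode M)" "x' \<in> mspace (cut_triode M)" for x x'
    using dis_f[OF that] dis_g'[OF f_in[OF that(1)] f_in[OF that(2)]] e by linarith
  note bar' = near_isometry_cut_triode(1,3)[OF M(1) n(1) g'f this]
  have "continuous_on {-1..1} (\<lambda>s. snd (g' (f (0, s))))"
    by (rule continuous_on_cut_triode_coords(2)[OF g'f, where \<gamma> = "\<lambda>s. (0, s)"])
       (auto simp: mdist_cut_triode_eq bar_in_cut_triode)
  \<comment> \<open>The bar may be mapped with either orientation, hence both the increasing and the
    decreasing form of the intermediate value theorem.\<close>
  then obtain t where t: "t \<in> {-1..1}" "snd (g' (f (0, t))) = 0"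
    using bar'(2) IVT'[of "\<lambda>s. snd (g' (f (0, s)))" "-1" 0 1] IVT2'[of "\<lambda>s. snd (g' (f (0, s)))" 1 0 "-1"]
    by (fastforce simp: mult_less_0_iff)
  then have gz: "g' (f (0, t)) = (0, 0)" using bar'(1) by (simp add: prod_eq_iff)
  let ?z = "f (0, t)" and ?w = "f' (1 / real n, 0)"
  have o: "(0, 0) \<in> mspace (cut_triode n)" and p: "(1 / real n, 0) \<in> mspace (cut_triode n)"
    using n(1) by (simp_all add: bar_in_cut_triode stem_in_cut_triode)
  have z: "?z \<in> mspace Z" using f_in bar_in_cut_triode t(1) by blast
  \<comment> \<open>Codistortion enters here: \<open>g'\<close> sends \<open>?z\<close> exactly to
    the branch point, so the distance on the side of \<open>cut_triode n\<close> is 0.\<close>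
  have "mdist Z (f' (0, 0)) ?z < 2 * e"
    using codis'[OF o z] gz o by (simp add: mdist_cut_triode_eq)
  moreover have "mdist Z (f' (0, 0)) ?w < 2 * e + 1 / real n"
    using dis_f'[OF o p] o p by (simp add: mdist_cut_triode_eq)
  moreover have "mdist Z ?z ?w \<le> mdist Z (f' (0, 0)) ?z + mdist Z (f' (0, 0)) ?w"
    using mdist_triangle[OF z f'_in[OF o] f'_in[OF p]] by (simp add: mdist_commute[of Z ?z])
  ultimately have "mdist Z ?z ?w < d" using e n(3) by linarith
  \<comment> \<open>So \<open>g\<close> sends \<open>?w\<close> into the bar, although
    \<open>?w\<close> is the image of a stem point and \<open>stem\<close> puts its image off the
    bar.\<close>
  then have "fst (g ?w) = 0" using d(2) t(1) f'_in[OF p] by blast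
  with stem[of "1 / real n"] n(1) show False by simp
qed

theorem theorem10p5:
  shows "(\<forall>\<epsilon>::real. \<epsilon> > 0 \<longrightarrow>
           (\<exists>N\<ge>1. \<forall>m\<ge>N. \<forall>n\<ge>N. dcGH (cut_triode m) (cut_triode n) < ennreal \<epsilon>))
       \<and> \<not> (\<exists>Z :: 'a metric. mspace Z \<noteq> {} \<and> (\<lambda>n. dcGH (cut_triode n) Z) \<longlonglongrightarrow> 0)"
proof (intro conjI allI impI)
  fix \<epsilon> :: real
  assume "0 < \<epsilon>"
  then obtain k where k: "inverse (real (Suc k)) < \<epsilon>" using reals_Archimedean by blast
  have "dcGH (cut_triode m) (cut_triode n) < ennreal \<epsilon>" if "Suc k \<le> m" "Suc k \<le> n" for m n
  proof -
    have "dcGH (cut_triode m) (cut_triode n) \<le> ennreal (1 / real (Suc k))"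
      by (rule dcGH_cut_triode_le) (use that in auto)
    also have "\<dots> < ennreal \<epsilon>" using k by (simp add: ennreal_less_iff inverse_eq_divide)
    finally show ?thesis .
  qed
  then show "\<exists>N\<ge>1. \<forall>m\<ge>N. \<forall>n\<ge>N. dcGH (cut_triode m) (cut_triode n) < ennreal \<epsilon>"
    by (intro exI[of _ "Suc k"]) simp
next
  show "\<not> (\<exists>Z :: 'a metric. mspace Z \<noteq> {} \<and> (\<lambda>n. dcGH (cut_triode n) Z) \<longlonglongrightarrow> 0)"
    using cut_triode_no_limit by blast
qed

end
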